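(* For each integer $n\geq 1$, there exists a 2-connected pseudo-outerplanar graph $G$ of order $2n+5$ with $\Delta(G)=3$ and $\chi'(G)=\Delta(G)+1=4$.
   Context: All graphs are finite, simple and undirected. A block is a maximal 2-connected subgraph. A graph is pseudo-outerplanar if each of its blocks can be drawn in the plane so that its vertices lie on a fixed circle, its edges lie inside the disk bounded by that circle, and each edge crosses at most one other edge. $\Delta(G)$ is the maximum degree of $G$, and $\chi'(G)$ is its edge chromatic number. *)

theory Defs
  imports "HOL-Analysis.Analysis" "Graph_Theory.Digraph_Component"
begin

text \<open>
  Finite simple undirected graphs are the members of the locale \<^locale>\<open>graph\<close>: finite,
  symmetric digraphs without loops or parallel arcs. An undirected edge \<open>uv\<close> is thus a pair
  of opposite arcs, and is represented by the set \<open>{u, v}\<close>.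
\<close>

definition edges :: "('a, 'b) pre_digraph \<Rightarrow> 'a set set" where
  "edges G = (\<lambda>e. {tail G e, head G e}) ` arcs G"

text \<open>In a symmetric digraph without parallel arcs the out-degree is the number of neighbours.\<close>

definition max_degree :: "('a, 'b) pre_digraph \<Rightarrow> nat" where
  "max_degree G = Max (out_degree G ` verts G)"

definition proper_edge_coloring :: "('a, 'b) pre_digraph \<Rightarrow> nat \<Rightarrow> ('a set \<Rightarrow> nat) \<Rightarrow> bool" where
  "proper_edge_coloring G k c \<longleftrightarrow> c ` edges G \<subseteq> {..<k} \<and>
     (\<forall>e\<in>edges G. \<forall>f\<in>edges G. e \<noteq> f \<and> e \<inter> f \<noteq> {} \<longrightarrow> c e \<noteq> c f)"

definition edge_chromatic_number :: "('a, 'b) pre_digraph \<Rightarrow> nat" where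
  "edge_chromatic_number G = (LEAST k. \<exists>c. proper_edge_coloring G k c)"

definition two_connected :: "('a, 'b) pre_digraph \<Rightarrow> bool" where
  "two_connected G \<longleftrightarrow> graph G \<and> card (verts G) > 2 \<and> Digraph_Component.connected G \<and>
     (\<forall>v\<in>verts G. Digraph_Component.connected (pre_digraph.del_vert G v))"

text \<open>
  Since \<^const>\<open>two_connected\<close> requires three vertices, a single edge (or vertex) is not a
  block here. For the definition of \<open>pseudo_outerplanar\<close> this is immaterial, because such
  graphs can always be drawn as required there.
\<close>

definition block :: "('a, 'b) pre_digraph \<Rightarrow> ('a, 'b) pre_digraph \<Rightarrow> bool" where
  "block G B \<longleftrightarrow> pre_digraph.max_subgraph G two_connected B"

text \<open>
  A drawing in the plane places the vertices at distinct points \<open>p v\<close> and represents each edge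
  \<open>e\<close> by a simple arc \<open>\<gamma> e\<close> that joins the points of its two ends and meets no other vertex.
  As usual, two edges share only finitely many points.
\<close>

definition drawing ::
  "('a, 'b) pre_digraph \<Rightarrow> ('a \<Rightarrow> complex) \<Rightarrow> ('a set \<Rightarrow> real \<Rightarrow> complex) \<Rightarrow> bool" where
  "drawing G p \<gamma> \<longleftrightarrow> inj_on p (verts G) \<and>
     (\<forall>e\<in>edges G. arc (\<gamma> e) \<and> {pathstart (\<gamma> e), pathfinish (\<gamma> e)} = p ` e \<and>
        path_image (\<gamma> e) \<inter> p ` verts G = p ` e) \<and>
     (\<forall>e\<in>edges G. \<forall>f\<in>edges G. e \<noteq> f \<longrightarrow> finite (path_image (\<gamma> e) \<inter> path_image (\<gamma> f)))"

text \<open>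
  Every common point of two edges other than a common end counts as a crossing; in particular
  edges are not allowed to touch each other for free.
\<close>

definition crosses ::
  "('a \<Rightarrow> complex) \<Rightarrow> ('a set \<Rightarrow> real \<Rightarrow> complex) \<Rightarrow> 'a set \<Rightarrow> 'a set \<Rightarrow> bool" where
  "crosses p \<gamma> e f \<longleftrightarrow> \<not> path_image (\<gamma> e) \<inter> path_image (\<gamma> f) \<subseteq> p ` (e \<inter> f)"

definition pseudo_outerplanar_drawing ::
  "('a, 'b) pre_digraph \<Rightarrow> ('a \<Rightarrow> complex) \<Rightarrow> ('a set \<Rightarrow> real \<Rightarrow> complex) \<Rightarrow> bool" where
  "pseudo_outerplanar_drawing G p \<gamma> \<longleftrightarrow> drawing G p \<gamma> \<and>
     (\<exists>z r. r > 0 \<and> p ` verts G \<subseteq> sphere z r \<and> (\<forall>e\<in>edges G. path_image (\<gamma> e) \<subseteq> cball z r)) \<and>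
     (\<forall>e\<in>edges G. card {f \<in> edges G. f \<noteq> e \<and> crosses p \<gamma> e f} \<le> 1)"

definition pseudo_outerplanar :: "('a, 'b) pre_digraph \<Rightarrow> bool" where
  "pseudo_outerplanar G \<longleftrightarrow> graph G \<and>
     (\<forall>B. block G B \<longrightarrow> (\<exists>p \<gamma>. pseudo_outerplanar_drawing B p \<gamma>))"

end

theory Submission
  imports Defs
begin

text \<open>The witness \<open>cubic_graph n\<close> is the cycle through 0, 1, ..., 2n+4 with the
  chords \<open>{0, 2}\<close>, \<open>{1, 3}\<close> and all {a, 2n+8-a} with 4 \<le> a < n+4.
  Every vertex meets exactly one chord except n+4, the fixed point of the reflection a -> 2n+8-a; so
  all degrees are 3, apart from a single 2.

  The Hamiltonian cycle makes the graph 2-connected, hence it is its own only block. With the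
  vertices in cyclic order on a circle and all edges straight, the reflected pairs are nested, and
  the only crossing is that of \<open>{0, 2}\<close> with \<open>{1, 3}\<close>. Whether two chords
  cross is decided by a sign, in \<open>chord_Int_chord_subset\<close>.

  Three colours fail by parity (\<open>no_proper_edge_coloring_odd\<close>): all of them occur at
  each vertex of degree 3, so the class of a colour seen at n+4 would be a perfect matching of an
  odd number of vertices. Four colours are given explicitly in
  \<open>proper_edge_coloring_cubic_graph\<close>.\<close>

section \<open>General facts on edge colourings and connectivity\<close>

lemma card_incident_edges:
  assumes "graph G"
  shows "finite (edges G)" "out_degree G v \<le> card {e \<in> edges G. v \<in> e}"
proof -
  interpret graph G by fact
  show fin: "finite (edges G)"
    by (simp add: edges_def)
  have "inj_on (\<lambda>e. {tail G e, head G e}) (out_arcs G v)"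
    by (rule inj_onI)
      (auto simp: doubleton_eq_iff arc_to_ends_def intro!: no_multi_arcs)
  then have "out_degree G v = card ((\<lambda>e. {tail G e, head G e}) ` out_arcs G v)"
    unfolding out_degree_def by (rule card_image[symmetric])
  also have "\<dots> \<le> card {e \<in> edges G. v \<in> e}"
    using fin by (intro card_mono) (auto simp: edges_def)
  finally show "out_degree G v \<le> card {e \<in> edges G. v \<in> e}" .
qed

text \<open>A colour used at \<open>s\<close> is used at every vertex, so its edges form a perfect matching.\<close>

lemma no_proper_edge_coloring_odd:
  assumes G: "graph G" and odd: "odd (card (verts G))"
    and s: "s \<in> verts G" "out_degree G s > 0"
    and deg: "\<And>v. v \<in> verts G \<Longrightarrow> v \<noteq> s \<Longrightarrow> k \<le> out_degree G v"
  shows "\<not> proper_edge_coloring G k c"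
proof
  assume c: "proper_edge_coloring G k c"
  interpret graph G by fact
  note fin = card_incident_edges(1)[OF G] and inc = card_incident_edges(2)[OF G]
  have "{e \<in> edges G. s \<in> e} \<noteq> {}"
    using inc[of s] s(2) by (metis card.empty leD)
  then obtain e0 where e0: "e0 \<in> edges G" "s \<in> e0"
    by auto
  \<comment> \<open>The colour is taken from an edge at \<open>s\<close> because \<open>s\<close>,
    unlike the other vertices, may miss some colours.\<close>
  define M where "M = {e \<in> edges G. c e = c e0}"
  have card2: "card e = 2" if "e \<in> M" for e
    using that no_loops by (auto simp: M_def edges_def)
  have disj: "pairwise disjnt M"
  proof (rule pairwiseI)
    fix e f assume "e \<in> M" "f \<in> M" "e \<noteq> f"
    then have "e \<in> edges G" "f \<in> edges G" "c e = c f"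
      by (simp_all add: M_def)
    with c \<open>e \<noteq> f\<close> show "disjnt e f"
      by (metis disjnt_def proper_edge_coloring_def)
  qed
  have "v \<in> \<Union>M" if v: "v \<in> verts G" for v
  proof (cases "v = s")
    case True
    then show ?thesis using e0 by (auto simp: M_def)
  next
    case False
    let ?E = "{e \<in> edges G. v \<in> e}"
    \<comment> \<open>Pigeonhole: at least \<open>k\<close> edges at \<open>v\<close> get distinct
      colours out of \<open>k\<close>, so every colour occurs at \<open>v\<close>.\<close>
    have "inj_on c ?E"
      using c by (auto simp: inj_on_def proper_edge_coloring_def)
    then have "k \<le> card (c ` ?E)"
      using deg[OF v False] inc[of v] by (simp add: card_image)
    moreover have "c ` ?E \<subseteq> {..<k}"
      using c by (auto simp: proper_edge_coloring_def)
    ultimately have "c ` ?E = {..<k}"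
      by (intro card_seteq) auto
    moreover have "c e0 \<in> {..<k}"
      using c e0 by (auto simp: proper_edge_coloring_def)
    ultimately obtain e where "e \<in> ?E" "c e = c e0"
      by (metis (no_types, lifting) imageE)
    then show ?thesis by (auto simp: M_def)
  qed
  moreover have "\<Union>M \<subseteq> verts G"
    by (auto simp: M_def edges_def)
  ultimately have "verts G = \<Union>M" by auto
  moreover have "card (\<Union>M) = sum card M"
    by (rule card_Union_disjoint[OF disj]) (metis card2 card.infinite zero_neq_numeral)
  ultimately have "card (verts G) = sum card M"
    by simp
  also have "\<dots> = 2 * card M"
    using card2 by simp
  finally show False using odd by simp
qed

text \<open>Library connectivity is strong connectivity of the symmetric closure. A symmetric
  digraph has the same adjacencies as its closure, and any two vertices are joined through
  \<open>r\<close>.\<close>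

lemma connected_if_reachable:
  assumes "wf_digraph G" "r \<in> verts G" "symmetric G" "\<And>v. v \<in> verts G \<Longrightarrow> r \<rightarrow>\<^sup>*\<^bsub>G\<^esub> v"
  shows "Digraph_Component.connected G"
proof -
  have eq: "arcs_ends (with_proj (mk_symmetric G)) = arcs_ends G"
    using assms(3) by (auto simp: mk_symmetric_def arcs_ends_conv symmetric_def sym_def image_iff)
  have *: "reachable (with_proj (mk_symmetric G)) = reachable G"
    by (intro ext) (unfold reachable_def eq, simp add: mk_symmetric_def)
  have "u \<rightarrow>\<^sup>*\<^bsub>G\<^esub> v" if "u \<in> verts G" "v \<in> verts G" for u v
    using that assms wf_digraph.reachable_trans[OF assms(1)] symmetric_reachable[OF assms(3)] by blast
  moreover have "verts (with_proj (mk_symmetric G)) = verts G"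
    by (simp add: mk_symmetric_def)
  ultimately show ?thesis
    using assms(2) unfolding Digraph_Component.connected_def strongly_connected_def * by auto
qed

section \<open>Chords of the unit circle\<close>

text \<open>Inverse stereographic projection from the north pole. Being rational, it reduces
  incidence and order on the circle to polynomial identities and signs.\<close>

definition circle_point :: "real \<Rightarrow> complex" where
  "circle_point t = Complex (2 * t / (t\<^sup>2 + 1)) ((t\<^sup>2 - 1) / (t\<^sup>2 + 1))"

text \<open>
  Stereographic projection identifies the circle with the parabola \<open>y = x\<^sup>2\<close>; under it the
  following affine form is \<open>y - (a + b) * x + a * b\<close>, which vanishes on the chord with
  parameters \<open>a\<close> and \<open>b\<close>.
\<close>

definition chord_form :: "real \<Rightarrow> real \<Rightarrow> complex \<Rightarrow> real" where
  "chord_form a b z = (1 + Im z) / 2 - (a + b) * Re z / 2 + a * b * (1 - Im z) / 2"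

text \<open>The denominator is positive, so the sign of (t - a) * (t - b) tells on which side of the
  chord the point lies.\<close>

lemma chord_form_circle_point:
  "chord_form a b (circle_point t) = (t - a) * (t - b) / (t\<^sup>2 + 1)"
proof -
  let ?z = "circle_point t"
  have "t\<^sup>2 + 1 \<noteq> 0" by (metis add.commute power_one sum_power2_eq_zero_iff zero_neq_one)
  then have "(1 + Im ?z) / 2 = t\<^sup>2 / (t\<^sup>2 + 1)" "Re ?z / 2 = t / (t\<^sup>2 + 1)"
    "(1 - Im ?z) / 2 = 1 / (t\<^sup>2 + 1)"
    by (simp_all add: circle_point_def field_simps)
  then have "chord_form a b ?z = (t\<^sup>2 - (a + b) * t + a * b) / (t\<^sup>2 + 1)"
    unfolding chord_form_def times_divide_eq_right[symmetric]
    by (simp only: add_divide_distrib diff_divide_distrib times_divide_eq_right mult_1_right)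
  also have "t\<^sup>2 - (a + b) * t + a * b = (t - a) * (t - b)"
    by (simp add: power2_eq_square algebra_simps)
  finally show ?thesis .
qed

lemma chord_form_eq_0_iff [simp]: "chord_form a b (circle_point t) = 0 \<longleftrightarrow> t = a \<or> t = b"
proof -
  have "t\<^sup>2 + 1 \<noteq> 0" by (metis add.commute power_one sum_power2_eq_zero_iff zero_neq_one)
  then show ?thesis by (simp add: chord_form_circle_point)
qed

lemma chord_form_ends [simp]:
  "chord_form a b (circle_point a) = 0" "chord_form a b (circle_point b) = 0"
  by (simp_all only: chord_form_eq_0_iff simp_thms)

text \<open>The forms separate points: for \<open>a = b = s\<close> the form is that of a tangent
  and vanishes only at parameter \<open>s\<close>.\<close>

lemma circle_point_eq_iff [simp]: "circle_point s = circle_point t \<longleftrightarrow> s = t"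
  by (metis chord_form_eq_0_iff)

lemma norm_circle_point [simp]: "norm (circle_point t) = 1"
proof -
  have "t\<^sup>2 + 1 \<noteq> 0" by (metis add.commute power_one sum_power2_eq_zero_iff zero_neq_one)
  moreover have "(2 * t)\<^sup>2 + (t\<^sup>2 - 1)\<^sup>2 = (t\<^sup>2 + 1)\<^sup>2"
    by (simp add: power2_eq_square algebra_simps)
  ultimately show ?thesis
    by (simp add: circle_point_def cmod_def power_divide flip: add_divide_distrib)
qed

lemma chord_form_segment:
  "chord_form a b ((1 - u) *\<^sub>R x + u *\<^sub>R y) = (1 - u) * chord_form a b x + u * chord_form a b y"
  by (simp add: chord_form_def algebra_simps add_divide_distrib diff_divide_distrib)

abbreviation chord :: "real \<Rightarrow> real \<Rightarrow> complex set" where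
  "chord a b \<equiv> closed_segment (circle_point a) (circle_point b)"

lemma chord_form_chord: "z \<in> chord a b \<Longrightarrow> chord_form a b z = 0"
  by (auto simp: closed_segment_def chord_form_segment)

lemma circle_point_in_chord_iff: "circle_point t \<in> chord a b \<longleftrightarrow> t = a \<or> t = b"
  using chord_form_chord by fastforce

text \<open>The form of the first chord is affine along the second and nonzero at one of its ends,
  so it has at most one zero there.\<close>

lemma finite_chord_Int_chord:
  assumes "c \<noteq> d" "{a, b} \<noteq> {c, d}"
  shows "finite (chord a b \<inter> chord c d)"
proof -
  let ?C = "chord_form a b (circle_point c)" and ?D = "chord_form a b (circle_point d)"
  have nz: "?C \<noteq> 0 \<or> ?D \<noteq> 0"
    using assms by auto
  have "u = C / (C - D)" if "(1 - u) * C + u * D = 0" "C \<noteq> 0 \<or> D \<noteq> 0" for u C D :: real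
  proof -
    have *: "u * (C - D) = C" using that(1) by (simp add: algebra_simps)
    then have "C - D \<noteq> 0" using that(2) by auto
    with * show ?thesis by (simp add: eq_divide_eq)
  qed
  from this[OF _ nz] have "u = ?C / (?C - ?D)" if "(1 - u) * ?C + u * ?D = 0" for u
    using that by blast
  moreover have "\<exists>u. z = (1 - u) *\<^sub>R circle_point c + u *\<^sub>R circle_point d \<and> (1 - u) * ?C + u * ?D = 0"
    if "z \<in> chord a b \<inter> chord c d" for z
    using that chord_form_chord[of z a b] by (auto simp: closed_segment_def chord_form_segment)
  ultimately have "chord a b \<inter> chord c d \<subseteq>
    {(1 - u) *\<^sub>R circle_point c + u *\<^sub>R circle_point d | u. u = ?C / (?C - ?D)}"
    by blast
  then show ?thesis by (rule finite_subset) simp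
qed

text \<open>The assumption \<open>side\<close> says that \<open>c\<close> and \<open>d\<close> are
  not strictly separated by the first chord. An affine function whose end values do not have
  opposite signs vanishes inside the segment only if it vanishes at both ends, which the other
  assumptions exclude.\<close>

lemma chord_Int_chord_subset:
  assumes "c \<noteq> d" "{a, b} \<noteq> {c, d}"
    and side: "0 \<le> ((c - a) * (c - b)) * ((d - a) * (d - b))"
  shows "chord a b \<inter> chord c d \<subseteq> circle_point ` ({a, b} \<inter> {c, d})"
proof
  let ?C = "chord_form a b (circle_point c)" and ?D = "chord_form a b (circle_point d)"
  fix z assume z: "z \<in> chord a b \<inter> chord c d"
  then obtain u where u: "0 \<le> u" "u \<le> 1"
    and z': "z = (1 - u) *\<^sub>R circle_point c + u *\<^sub>R circle_point d"
    by (auto simp: closed_segment_def)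
  have eq: "(1 - u) * ?C + u * ?D = 0"
    using z chord_form_chord[of z a b] by (simp add: z' chord_form_segment)
  have "0 \<le> ?C * ?D"
    using side by (simp add: chord_form_circle_point)
  \<comment> \<open>The two summands in \<open>eq\<close> add up to zero, so their product is minus
    a square; being nonnegative, it is zero.\<close>
  then have "0 \<le> ((1 - u) * u) * (?C * ?D)"
    using u by (intro mult_nonneg_nonneg[OF mult_nonneg_nonneg]) auto
  moreover have "u * ?D = - ((1 - u) * ?C)"
    using eq by linarith
  then have "((1 - u) * u) * (?C * ?D) = - ((1 - u) * ?C)\<^sup>2"
    by (simp add: power2_eq_square mult.assoc mult.left_commute[of u])
  ultimately have "(1 - u) * ?C = 0"
    by (metis neg_0_le_iff_le zero_le_power2 order_antisym zero_eq_power2)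
  then have C: "u = 1 \<or> c \<in> {a, b}" and D: "u = 0 \<or> d \<in> {a, b}"
    using eq by auto
  moreover have "\<not> (c \<in> {a, b} \<and> d \<in> {a, b})"
    using assms by auto
  ultimately have "z = circle_point c \<and> c \<in> {a, b} \<or> z = circle_point d \<and> d \<in> {a, b}"
    by (auto simp: z')
  then show "z \<in> circle_point ` ({a, b} \<inter> {c, d})"
    by auto
qed

section \<open>The graph and its 2-connectedness\<close>

text \<open>
  A cycle of odd length \<open>2 * n + 5\<close> with two crossing chords at one end and parallel chords
  between the two remaining paths; only the vertex \<open>n + 4\<close> meets no chord.
\<close>

definition cubic_edge :: "nat \<Rightarrow> nat \<Rightarrow> nat \<Rightarrow> bool" where
  "cubic_edge n a b \<longleftrightarrow> b = Suc a \<and> b < 2 * n + 5 \<or> a = 0 \<and> b = 2 * n + 4 \<or>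
     a = 0 \<and> b = 2 \<or> a = 1 \<and> b = 3 \<or> 4 \<le> a \<and> a < b \<and> a + b = 2 * n + 8"

definition cubic_graph :: "nat \<Rightarrow> (nat, nat \<times> nat) pre_digraph" where
  "cubic_graph n = \<lparr>verts = {..<2 * n + 5}, arcs = {(u, v). cubic_edge n u v \<or> cubic_edge n v u},
     tail = fst, head = snd\<rparr>"

lemma cubic_edge_bounds: "n \<ge> 1 \<Longrightarrow> cubic_edge n a b \<Longrightarrow> a < b \<and> b < 2 * n + 5"
  by (auto simp: cubic_edge_def)

lemma edges_cubic_graph: "edges (cubic_graph n) = {{a, b} | a b. cubic_edge n a b}"
  by (fastforce simp: edges_def cubic_graph_def image_iff doubleton_eq_iff)

lemma edges_cubic_graphE:
  assumes "n \<ge> 1" "e \<in> edges (cubic_graph n)"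
  obtains a b where "e = {a, b}" "cubic_edge n a b" "a < b" "b < 2 * n + 5"
  using assms cubic_edge_bounds by (auto simp: edges_cubic_graph)

lemma graph_cubic_graph:
  assumes "n \<ge> 1"
  shows "graph (cubic_graph n)"
proof
  have "arcs (cubic_graph n) \<subseteq> {..<2 * n + 5} \<times> {..<2 * n + 5}"
    using cubic_edge_bounds[OF assms] by (fastforce simp: cubic_graph_def)
  then show "finite (arcs (cubic_graph n))"
    by (rule finite_subset) simp
qed (use cubic_edge_bounds[OF assms] in
    \<open>fastforce simp: cubic_graph_def arc_to_ends_def symmetric_conv\<close>)+

text \<open>Only the Hamiltonian cycle is used: removing a vertex leaves a path.\<close>

lemma two_connected_cubic_graph:
  assumes n: "n \<ge> 1"
  shows "two_connected (cubic_graph n)"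
proof -
  let ?G = "cubic_graph n"
  interpret graph ?G by (rule graph_cubic_graph[OF n])
  have verts_G: "verts ?G = {..<2 * n + 5}"
    by (simp add: cubic_graph_def)
  have "0 \<rightarrow>\<^sup>*\<^bsub>?G\<^esub> v" if "v < 2 * n + 5" for v
    using that
  proof (induction v)
    case (Suc v)
    have "v \<rightarrow>\<^bsub>?G\<^esub> Suc v"
      using Suc.prems by (auto simp: arcs_ends_conv cubic_graph_def cubic_edge_def image_iff)
    with Suc show ?case
      by (meson Suc_lessD reachable_adj_trans)
  qed (simp add: verts_G)
  then have conn: "Digraph_Component.connected ?G"
    by (intro connected_if_reachable[of _ 0]) (use wf_digraph_axioms sym_arcs in \<open>simp_all add: verts_G\<close>)
  have "Digraph_Component.connected (pre_digraph.del_vert ?G w)" if w: "w < 2 * n + 5" for w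
  proof -
    let ?H = "del_vert w"
    interpret H: wf_digraph ?H by (rule wf_digraph_del_vert)
    have verts: "verts ?H = {..<2 * n + 5} - {w}"
      by (simp add: verts_del_vert verts_G)
    have adj: "u \<rightarrow>\<^bsub>?H\<^esub> v" if "u \<noteq> w" "v \<noteq> w" "cubic_edge n u v \<or> cubic_edge n v u" for u v
      using that unfolding arcs_ends_conv del_vert_simps by (auto simp: cubic_graph_def image_iff)
    have sym: "symmetric ?H"
      using sym_arcs by (fastforce simp: symmetric_conv del_vert_simps)
    have low: "0 \<rightarrow>\<^sup>*\<^bsub>?H\<^esub> v" if "v < w" for v
      using that
    proof (induction v)
      case (Suc v)
      have "v \<rightarrow>\<^bsub>?H\<^esub> Suc v"
        using Suc.prems w by (intro adj) (auto simp: cubic_edge_def)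
      with Suc show ?case
        by (meson Suc_lessD H.reachable_adj_trans)
    qed (use w in \<open>simp add: verts\<close>)
    \<comment> \<open>Downward induction from the last vertex, along the part of the cycle above
      \<open>w\<close>.\<close>
    have high: "(2 * n + 4) \<rightarrow>\<^sup>*\<^bsub>?H\<^esub> v" if "w < v" "v \<le> 2 * n + 4" for v
      using that(2,1)
    proof (induction rule: inc_induct)
      case base
      then show ?case by (simp add: verts)
    next
      case (step v)
      have "Suc v \<rightarrow>\<^bsub>?H\<^esub> v"
        using step by (intro adj) (auto simp: cubic_edge_def)
      with step show ?case
        by (meson less_SucI H.reachable_adj_trans)
    qed
    show ?thesis
    proof (cases "w = 2 * n + 4")
      case True
      then have "0 \<in> verts ?H" "\<And>v. v \<in> verts ?H \<Longrightarrow> v < w"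
        unfolding verts by auto
      then show ?thesis
        using low by (intro connected_if_reachable[OF H.wf_digraph _ sym]) blast+
    next
      case False
      \<comment> \<open>The closing edge of the cycle links the parts above and below
        \<open>w\<close>; for \<open>w = 0\<close> there is no part below.\<close>
      have "(2 * n + 4) \<rightarrow>\<^bsub>?H\<^esub> 0" if "w \<noteq> 0"
        using that False by (intro adj) (auto simp: cubic_edge_def)
      then have "(2 * n + 4) \<rightarrow>\<^sup>*\<^bsub>?H\<^esub> v" if "v < w" for v
        using that low by (metis H.adj_reachable_trans not_less0)
      with high have "(2 * n + 4) \<rightarrow>\<^sup>*\<^bsub>?H\<^esub> v" if "v \<in> verts ?H" for v
        using that unfolding verts by (cases v w rule: linorder_cases) auto
      moreover have "2 * n + 4 \<in> verts ?H"
        using False unfolding verts by simp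
      ultimately show ?thesis
        by (intro connected_if_reachable[OF H.wf_digraph _ sym])
    qed
  qed
  then show ?thesis
    using conn graph_cubic_graph[OF n] by (auto simp: two_connected_def verts_G)
qed

section \<open>The drawing and its single crossing\<close>

text \<open>Nothing lies between consecutive numbers, nothing lies beyond the closing edge, and
  pairs with the same sum are nested. Only the two short chords can interleave.\<close>

lemma cubic_edge_crossing:
  assumes "n \<ge> 1" "cubic_edge n a b" "cubic_edge n c d"
    and "a < c" "c < b" "b < d"
  shows "a = 0" "b = 2" "c = 1" "d = 3"
  using assms by (auto simp: cubic_edge_def)

lemma cubic_edge_chords:
  assumes n: "n \<ge> 1" and ab: "cubic_edge n a b" and cd: "cubic_edge n c d"
    and ne: "{a, b} \<noteq> {c, d}"
    and special: "{{a, b}, {c, d}} \<noteq> {{0, 2}, {1, 3}}"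
  shows "chord a b \<inter> chord c d \<subseteq> (circle_point \<circ> real) ` ({a, b} \<inter> {c, d})"
proof -
  have lt: "a < b" "c < d"
    using cubic_edge_bounds n ab cd by auto
  have "\<not> (a < c \<and> c < b \<and> b < d)"
    using cubic_edge_crossing[OF n ab cd] special by blast
  moreover have "\<not> (c < a \<and> a < d \<and> d < b)"
    using cubic_edge_crossing[OF n cd ab] special insert_commute[of "{1, 3}" "{0, 2}" "{}"] by auto
  \<comment> \<open>Without interleaving, \<open>c\<close> and \<open>d\<close> lie both outside or
    both inside the interval from \<open>a\<close> to \<open>b\<close>, ends allowed; so the two
    factors in \<open>side\<close> have no opposite signs.\<close>
  ultimately consider "c \<le> a \<or> b \<le> c" "d \<le> a \<or> b \<le> d" | "a \<le> c" "c \<le> b" "a \<le> d" "d \<le> b"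
    using lt by linarith
  then have side: "0 \<le> ((real c - a) * (real c - b)) * ((real d - a) * (real d - b))"
  proof cases
    case 1
    have outside: "0 \<le> (real x - a) * (real x - b)" if "x \<le> a \<or> b \<le> x" for x
      using that lt by (elim disjE) (auto intro: mult_nonneg_nonneg mult_nonpos_nonpos)
    show ?thesis by (rule mult_nonneg_nonneg[OF outside[OF 1(1)] outside[OF 1(2)]])
  next
    case 2
    then show ?thesis by (intro mult_nonpos_nonpos mult_nonneg_nonpos) auto
  qed
  have "{real a, real b} \<noteq> {real c, real d}"
    using ne by (auto simp: doubleton_eq_iff)
  then have "chord a b \<inter> chord c d \<subseteq> circle_point ` ({real a, real b} \<inter> {real c, real d})"
    using lt side by (intro chord_Int_chord_subset) auto
  also have "\<dots> \<subseteq> (circle_point \<circ> real) ` ({a, b} \<inter> {c, d})"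
    by auto
  finally show ?thesis .
qed

lemma pseudo_outerplanar_drawing_cubic_graph:
  assumes n: "n \<ge> 1"
  shows "\<exists>p \<gamma>. pseudo_outerplanar_drawing (cubic_graph n) p \<gamma>"
proof -
  let ?G = "cubic_graph n"
  define p where "p = circle_point \<circ> real"
  \<comment> \<open>Edges are unordered sets; \<open>Min\<close> and \<open>Max\<close> choose a
    direction for the segment.\<close>
  define \<gamma> where "\<gamma> e = linepath (p (Min e)) (p (Max e))" for e :: "nat set"
  have \<gamma>: "\<gamma> {a, b} = linepath (circle_point a) (circle_point b)" if "a < b" for a b
    using that by (simp add: \<gamma>_def p_def)
  note E = edges_cubic_graphE[OF n]
  have "drawing ?G p \<gamma>"
    unfolding drawing_def
  proof (intro conjI ballI impI)
    show "inj_on p (verts ?G)"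
      by (simp add: p_def inj_on_def)
  next
    fix e assume "e \<in> edges ?G"
    then obtain a b where e: "e = {a, b}" "a < b" "b < 2 * n + 5"
      by (blast elim: E)
    show "arc (\<gamma> e)" "{pathstart (\<gamma> e), pathfinish (\<gamma> e)} = p ` e"
      using e by (auto simp: \<gamma> p_def)
    show "path_image (\<gamma> e) \<inter> p ` verts ?G = p ` e"
      using e by (auto simp: \<gamma> p_def cubic_graph_def circle_point_in_chord_iff)
  next
    fix e f assume ef: "e \<in> edges ?G" "f \<in> edges ?G" and ne: "e \<noteq> f"
    obtain a b where e: "e = {a, b}" "a < b"
      using ef(1) by (blast elim: E)
    obtain c d where f: "f = {c, d}" "c < d"
      using ef(2) by (blast elim: E)
    have "{real a, real b} \<noteq> {real c, real d}"
      using ne e f by (auto simp: doubleton_eq_iff)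
    then have "finite (chord a b \<inter> chord c d)"
      using f by (intro finite_chord_Int_chord) auto
    then show "finite (path_image (\<gamma> e) \<inter> path_image (\<gamma> f))"
      using e f by (simp add: \<gamma>)
  qed
  moreover have "p ` verts ?G \<subseteq> sphere 0 1"
    by (auto simp: p_def)
  moreover have "path_image (\<gamma> e) \<subseteq> cball 0 1" for e
    unfolding \<gamma>_def path_image_linepath by (rule closed_segment_subset) (auto simp: p_def)
  moreover have "card {f \<in> edges ?G. f \<noteq> e \<and> crosses p \<gamma> e f} \<le> 1" if e: "e \<in> edges ?G" for e
  proof -
    \<comment> \<open>The partner of \<open>e\<close> is determined by \<open>e\<close>. If
      \<open>e\<close> is neither of the two crossing chords, no such \<open>f\<close> exists and
      the \<open>else\<close> value is a dummy.\<close>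
    have "f = (if e = {0, 2} then {1, 3} else {0, 2})"
      if f: "f \<in> edges ?G" "f \<noteq> e" "crosses p \<gamma> e f" for f
    proof -
      obtain a b where ab: "e = {a, b}" "cubic_edge n a b" "a < b"
        using e by (blast elim: E)
      obtain c d where cd: "f = {c, d}" "cubic_edge n c d" "c < d"
        using f(1) by (blast elim: E)
      have "{e, f} = {{0, 2}, {1, 3}}"
      proof (rule ccontr)
        assume "{e, f} \<noteq> {{0, 2}, {1, 3}}"
        then have "chord a b \<inter> chord c d \<subseteq> p ` (e \<inter> f)"
          using cubic_edge_chords[OF n ab(2) cd(2)] f(2) unfolding ab(1) cd(1) p_def by metis
        then show False
          using f(3) by (simp add: crosses_def ab cd \<gamma>)
      qed
      then have "e = {0, 2} \<and> f = {1, 3} \<or> e = {1, 3} \<and> f = {0, 2}"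
        by (metis doubleton_eq_iff)
      moreover have "{1, 3} \<noteq> {0, 2 :: nat}"
        by (simp add: doubleton_eq_iff)
      ultimately show ?thesis by metis
    qed
    then have "{f \<in> edges ?G. f \<noteq> e \<and> crosses p \<gamma> e f} \<subseteq> {if e = {0, 2} then {1, 3} else {0, 2}}"
      by blast
    then have "card {f \<in> edges ?G. f \<noteq> e \<and> crosses p \<gamma> e f} \<le> card {if e = {0, 2} then {1, 3} else {0::nat, 2}}"
      by (rule card_mono[rotated]) simp
    then show ?thesis by simp
  qed
  ultimately have "pseudo_outerplanar_drawing ?G p \<gamma>"
    unfolding pseudo_outerplanar_drawing_def using zero_less_one by blast
  then show ?thesis by blast
qed

text \<open>The graph is itself a 2-connected subgraph containing \<open>B\<close>, so maximality of
  \<open>B\<close> forces equality. Hence one drawing of the whole graph suffices.\<close>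

lemma block_two_connected:
  assumes "two_connected G" "block G B"
  shows "B = G"
proof -
  interpret graph G using assms by (simp add: two_connected_def)
  show ?thesis
    using assms subgraph_refl by (auto simp: block_def max_subgraph_def)
qed

section \<open>Vertex degrees and a colouring with four colours\<close>

lemma out_degree_cubic_graph:
  "out_degree (cubic_graph n) v = card {w. cubic_edge n v w \<or> cubic_edge n w v}"
proof -
  have "out_arcs (cubic_graph n) v = Pair v ` {w. cubic_edge n v w \<or> cubic_edge n w v}"
    by (auto simp: cubic_graph_def)
  then show ?thesis
    by (simp add: out_degree_def card_image inj_on_def)
qed

lemma out_degree_cubic_graph_eq:
  assumes n: "n \<ge> 1" and v: "v < 2 * n + 5"
  shows "out_degree (cubic_graph n) v = (if v = n + 4 then 2 else 3)"
proof -
  consider "v = 0" | "v = 1" | "v = 2" | "v = 3" | "v = n + 4"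
    | "4 \<le> v" "v \<noteq> n + 4" "v < 2 * n + 4" | "v = 2 * n + 4"
    using v by linarith
  then show ?thesis
  proof cases
    case 1
    then have "{w. cubic_edge n v w \<or> cubic_edge n w v} = {1, 2, 2 * n + 4}"
      using n by (auto simp: cubic_edge_def)
    then show ?thesis using 1 n by (simp add: out_degree_cubic_graph)
  next
    case 2
    then have "{w. cubic_edge n v w \<or> cubic_edge n w v} = {0, 2, 3}"
      using n by (auto simp: cubic_edge_def)
    then show ?thesis using 2 n by (simp add: out_degree_cubic_graph)
  next
    case 3
    then have "{w. cubic_edge n v w \<or> cubic_edge n w v} = {0, 1, 3}"
      using n by (auto simp: cubic_edge_def)
    then show ?thesis using 3 n by (simp add: out_degree_cubic_graph)
  next
    case 4
    then have "{w. cubic_edge n v w \<or> cubic_edge n w v} = {1, 2, 4}"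
      using n by (auto simp: cubic_edge_def)
    then show ?thesis using 4 n by (simp add: out_degree_cubic_graph)
  next
    case 5
    then have "{w. cubic_edge n v w \<or> cubic_edge n w v} = {n + 3, n + 5}"
      using n by (auto simp: cubic_edge_def)
    then show ?thesis using 5 n by (simp add: out_degree_cubic_graph)
  next
    case 6
    then have "{w. cubic_edge n v w \<or> cubic_edge n w v} = {v - 1, v + 1, 2 * n + 8 - v}"
      using n by (auto simp: cubic_edge_def)
    \<comment> \<open>Parity: v and 2n+8-v differ by an even number, so the chord never ends at a
      cycle neighbour.\<close>
    moreover have "v - 1 \<noteq> v + 1" "v - 1 \<noteq> 2 * n + 8 - v" "v + 1 \<noteq> 2 * n + 8 - v"
      using 6 by presburger+
    ultimately show ?thesis using 6 n by (simp add: out_degree_cubic_graph)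
  next
    case 7
    then have "{w. cubic_edge n v w \<or> cubic_edge n w v} = {0, 4, 2 * n + 3}"
      using n by (auto simp: cubic_edge_def)
    then show ?thesis using 7 n by (simp add: out_degree_cubic_graph)
  qed
qed

text \<open>
  Alternate along the odd cycle and give its closing edge a third colour; the chords form a
  matching and take the fourth.
\<close>

lemma proper_edge_coloring_cubic_graph:
  assumes n: "n \<ge> 1"
  shows "\<exists>c. proper_edge_coloring (cubic_graph n) 4 c"
proof -
  define c where "c e = (if Max e = Suc (Min e) then Min e mod 2
    else if Min e = 0 \<and> Max e = 2 * n + 4 then 2 else 3)" for e :: "nat set"
  have c: "c {a, b} = (if b = Suc a then a mod 2 else if a = 0 \<and> b = 2 * n + 4 then 2 else 3)"
    if "a < b" for a b
    using that by (simp add: c_def)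
  note E = edges_cubic_graphE[OF n]
  have kinds: "b = Suc a \<and> c {a, b} = a mod 2 \<or> a = 0 \<and> b = 2 * n + 4 \<and> c {a, b} = 2 \<or>
    (a = 0 \<and> b = 2 \<or> a = 1 \<and> b = 3 \<or> 4 \<le> a \<and> a < b \<and> a + b = 2 * n + 8) \<and> c {a, b} = 3"
    if "cubic_edge n a b" for a b
  proof -
    \<comment> \<open>The ends of a reflected chord have even sum, so \<open>c\<close> does not
      mistake it for a cycle edge.\<close>
    have "4 \<le> a \<Longrightarrow> a + b = 2 * n + 8 \<Longrightarrow> b \<noteq> Suc a"
      by presburger
    then show ?thesis
      using that n c cubic_edge_bounds[OF n that] by (auto simp: cubic_edge_def)
  qed
  have "c e \<in> {..<4}" for e
    using mod_less_divisor[of 2 "Min e"] by (auto simp: c_def)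
  moreover have "c e \<noteq> c f"
    if ef: "e \<in> edges (cubic_graph n)" "f \<in> edges (cubic_graph n)" "e \<noteq> f" "e \<inter> f \<noteq> {}" for e f
  proof -
    obtain a b where ab: "e = {a, b}" "cubic_edge n a b"
      using ef(1) by (blast elim: E)
    obtain a' b' where ab': "f = {a', b'}" "cubic_edge n a' b'"
      using ef(2) by (blast elim: E)
    have meet: "a = a' \<and> b \<noteq> b' \<or> a \<noteq> a' \<and> b = b' \<or> a = b' \<or> b = a'"
      using ef ab ab' by auto
    have parity: "x mod 2 \<noteq> Suc x mod 2" "x mod 2 \<noteq> 2" "x mod 2 \<noteq> 3" for x :: nat
      by presburger+
    show ?thesis
      using kinds[OF ab(2)] kinds[OF ab'(2)]
    \<comment> \<open>In case 1 both edges join consecutive numbers; if distinct and adjacent, they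
      start at consecutive numbers and alternate in colour. All other pairs differ in colour,
      coincide or are disjoint.\<close>
    proof (elim disjE conjE, goal_cases)
      case 1
      then show ?case using meet parity(1)[of a] parity(1)[of a'] by (auto simp: ab(1) ab'(1))
    qed (use meet n in \<open>auto simp: ab(1) ab'(1) parity parity[symmetric]\<close>)
  qed
  ultimately have "proper_edge_coloring (cubic_graph n) 4 c"
    unfolding proper_edge_coloring_def by blast
  then show ?thesis by blast
qed

theorem theorem5p4:
  fixes n :: nat
  assumes "n \<ge> 1"
  shows "\<exists>G :: (nat, nat \<times> nat) pre_digraph.
    graph G \<and> two_connected G \<and> pseudo_outerplanar G \<and> card (verts G) = 2 * n + 5 \<and>
    max_degree G = 3 \<and> edge_chromatic_number G = max_degree G + 1 \<and> edge_chromatic_number G = 4"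
proof -
  let ?G = "cubic_graph n"
  note graph = graph_cubic_graph[OF assms] and two = two_connected_cubic_graph[OF assms]
    and deg = out_degree_cubic_graph_eq[OF assms]
  have verts: "verts ?G = {..<2 * n + 5}"
    by (simp add: cubic_graph_def)
  have "pseudo_outerplanar ?G"
    using graph two block_two_connected pseudo_outerplanar_drawing_cubic_graph[OF assms]
    by (auto simp: pseudo_outerplanar_def)
  moreover have "max_degree ?G = 3"
    unfolding max_degree_def
  proof (rule Max_eqI)
    show "3 \<in> out_degree ?G ` verts ?G"
      using deg[of 0] by (auto simp: verts image_iff intro!: bexI[of _ 0])
  qed (auto simp: verts deg)
  moreover have "edge_chromatic_number ?G = 4"
    unfolding edge_chromatic_number_def
  proof (rule Least_equality)
    show "\<exists>c. proper_edge_coloring ?G 4 c"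
      by (rule proper_edge_coloring_cubic_graph[OF assms])
  next
    fix k assume "\<exists>c. proper_edge_coloring ?G k c"
    then obtain c where "proper_edge_coloring ?G k c" ..
    \<comment> \<open>The exceptional vertex is n+4, of degree 2; all others have degree 3, which
      covers every k \<le> 3 at once.\<close>
    moreover have "\<not> proper_edge_coloring ?G k c" if "k \<le> 3"
      using that by (intro no_proper_edge_coloring_odd[where s = "n + 4"]) (auto simp: graph verts deg)
    ultimately show "4 \<le> k" by linarith
  qed
  ultimately show ?thesis
    using graph two by (intro exI[of _ ?G]) (simp add: verts)
qed

end
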